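(* Let $K$ be a field, let $H$ be a finite dimensional split semisimple Hopf algebra over $K$, and let $0\neq\Lambda\in H$ be an integral. Assume that the Wedderburn decomposition of $H$ is $\mathrm{M}_{n_1}(K)\times\cdots\times\mathrm{M}_{n_s}(K)$. The following assertions are equivalent: (i) $H$ is involutory, i.e. its antipode $S$ satisfies $S^2=\mathrm{id}$. (ii) The Casimir element $C=\Lambda_{(1)}\otimes S(\Lambda_{(2)})\in H\otimes H$ can be written as $$C=\sum_{i=1}^s\frac{\varepsilon(\Lambda)}{n_i}\,C_i,$$ where $C_i$ is the image in $H\otimes H$ of the Casimir element of $\mathrm{M}_{n_i}(K)$ associated to the trace.
   Context: Here $\varepsilon$ and $S$ are the counit and antipode of $H$, and $\Delta(h)=h_{(1)}\otimes h_{(2)}$ is Sweedler notation. In a semisimple Hopf algebra left and right integrals coincide. The Casimir element of the matrix algebra $\mathrm{M}_n(K)$ associated to the trace (i.e. to the nondegenerate associative bilinear form $(P,Q)\mapsto \mathrm{tr}(PQ)$) is $\sum_{k,l=1}^n T_{kl}\otimes T_{lk}\in \mathrm{M}_n(K)\otimes\mathrm{M}_n(K)$, where $T_{kl}$ is the matrix with $1$ in the $(k,l)$-entry and zero elsewhere. The image $C_i$ is taken under the (non-unital) inclusion $\mathrm{M}_{n_i}(K)\otimes\mathrm{M}_{n_i}(K)\hookrightarrow H\otimes H$ given by the $i$-th factor of the Wedderburn decomposition. Assertion (ii) is understood to include that the fractions make sense, i.e. that each $n_i$ is nonzero in $K$. *)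

theory Defs
  imports
    "HOL-Library.Poly_Mapping"
    "HOL-Library.FuncSet"
    "Jordan_Normal_Form.Matrix"
begin

section \<open>Tensor powers as quotients of free vector spaces\<close>

definition free_scale :: "'k::field \<Rightarrow> ('a \<Rightarrow>\<^sub>0 'k) \<Rightarrow> ('a \<Rightarrow>\<^sub>0 'k)" where
  "free_scale c u = Poly_Mapping.map ((*) c) u"

lemma lookup_free_scale [simp]:
  "Poly_Mapping.lookup (free_scale c u) a = c * Poly_Mapping.lookup u a"
  unfolding free_scale_def by transfer (simp add: when_def)

interpretation free: vector_space free_scale
  by unfold_locales (rule poly_mapping_eqI, simp add: lookup_add algebra_simps)+

definition lin_ext ::
    "('k::zero \<Rightarrow> 'v \<Rightarrow> 'v) \<Rightarrow> ('a \<Rightarrow> 'v::comm_monoid_add) \<Rightarrow> ('a \<Rightarrow>\<^sub>0 'k) \<Rightarrow> 'v" where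
  "lin_ext scale f u = (\<Sum>a\<in>Poly_Mapping.keys u. scale (Poly_Mapping.lookup u a) (f a))"

abbreviation basis :: "'a \<Rightarrow> ('a \<Rightarrow>\<^sub>0 'k::zero_neq_one)" where
  "basis a \<equiv> Poly_Mapping.single a 1"

text \<open>In the following definitions \<open>scale\<close> is the scalar multiplication of a vector space \<open>V\<close>.
  An element of \<open>V \<otimes> V\<close> is a coset of the subspace spanned by the bilinearity relations, in the
  free vector space on \<open>V \<times> V\<close>, and similarly for \<open>V \<otimes> V \<otimes> V\<close>. Sums and scalar
  multiples of cosets are the cosets of the sums and scalar multiples of representatives.\<close>

definition bilinear_relations ::
    "('k::field \<Rightarrow> 'v::ab_group_add \<Rightarrow> 'v) \<Rightarrow> ('v \<times> 'v \<Rightarrow>\<^sub>0 'k) set" where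
  "bilinear_relations scale =
     {basis (x + x', y) - basis (x, y) - basis (x', y) | x x' y. True} \<union>
     {basis (x, y + y') - basis (x, y) - basis (x, y') | x y y'. True} \<union>
     {basis (scale c x, y) - free_scale c (basis (x, y)) | c x y. True} \<union>
     {basis (x, scale c y) - free_scale c (basis (x, y)) | c x y. True}"

definition trilinear_relations ::
    "('k::field \<Rightarrow> 'v::ab_group_add \<Rightarrow> 'v) \<Rightarrow> ('v \<times> 'v \<times> 'v \<Rightarrow>\<^sub>0 'k) set" where
  "trilinear_relations scale =
     {basis (x + x', y, z) - basis (x, y, z) - basis (x', y, z) | x x' y z. True} \<union>
     {basis (x, y + y', z) - basis (x, y, z) - basis (x, y', z) | x y y' z. True} \<union>
     {basis (x, y, z + z') - basis (x, y, z) - basis (x, y, z') | x y z z'. True} \<union>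
     {basis (scale c x, y, z) - free_scale c (basis (x, y, z)) | c x y z. True} \<union>
     {basis (x, scale c y, z) - free_scale c (basis (x, y, z)) | c x y z. True} \<union>
     {basis (x, y, scale c z) - free_scale c (basis (x, y, z)) | c x y z. True}"

definition tensor2_rel :: "('k::field \<Rightarrow> 'v::ab_group_add \<Rightarrow> 'v) \<Rightarrow> ('v \<times> 'v \<Rightarrow>\<^sub>0 'k) rel" where
  "tensor2_rel scale = {(u, v). u - v \<in> free.span (bilinear_relations scale)}"

definition tensor3_rel ::
    "('k::field \<Rightarrow> 'v::ab_group_add \<Rightarrow> 'v) \<Rightarrow> ('v \<times> 'v \<times> 'v \<Rightarrow>\<^sub>0 'k) rel" where
  "tensor3_rel scale = {(u, v). u - v \<in> free.span (trilinear_relations scale)}"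

lemma equiv_diff_span: "equiv UNIV {(u, v). u - v \<in> free.span R}"
proof (rule equivI)
  show "refl {(u, v). u - v \<in> free.span R}"
    by (rule refl_onI) (simp add: free.span_zero)
  show "sym {(u, v). u - v \<in> free.span R}"
  proof (rule symI, clarify)
    fix u v assume "u - v \<in> free.span R"
    from free.span_neg[OF this] show "v - u \<in> free.span R" by simp
  qed
  show "trans {(u, v). u - v \<in> free.span R}"
  proof (rule transI, clarify)
    fix u v w assume "u - v \<in> free.span R" "v - w \<in> free.span R"
    from free.span_add[OF this] show "u - w \<in> free.span R" by simp
  qed
qed simp

lemma equiv_tensor2_rel: "equiv UNIV (tensor2_rel scale)"
  unfolding tensor2_rel_def by (rule equiv_diff_span)

lemma equiv_tensor3_rel: "equiv UNIV (tensor3_rel scale)"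
  unfolding tensor3_rel_def by (rule equiv_diff_span)

definition tensor2 ::
    "('k::field \<Rightarrow> 'v::ab_group_add \<Rightarrow> 'v) \<Rightarrow> ('v \<times> 'v \<Rightarrow>\<^sub>0 'k) \<Rightarrow> ('v \<times> 'v \<Rightarrow>\<^sub>0 'k) set" where
  "tensor2 scale u = tensor2_rel scale `` {u}"

definition tensor_square ::
    "('k::field \<Rightarrow> 'v::ab_group_add \<Rightarrow> 'v) \<Rightarrow> ('v \<times> 'v \<Rightarrow>\<^sub>0 'k) set set" where
  "tensor_square scale = UNIV // tensor2_rel scale"

definition free_map2 ::
    "('v \<Rightarrow> 'w) \<Rightarrow> ('v \<Rightarrow> 'w) \<Rightarrow> ('v \<times> 'v \<Rightarrow>\<^sub>0 'k::field) \<Rightarrow> ('w \<times> 'w \<Rightarrow>\<^sub>0 'k)" where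
  "free_map2 f g = lin_ext free_scale (\<lambda>(a, b). basis (f a, g b))"

text \<open>For linear \<open>f\<close> and \<open>g\<close>, \<open>tensor_map scale f g\<close> is the map
  \<open>f \<otimes> g\<close> on \<open>V \<otimes> V\<close>.\<close>

definition tensor_map ::
    "('k::field \<Rightarrow> 'v::ab_group_add \<Rightarrow> 'v) \<Rightarrow> ('v \<Rightarrow> 'v) \<Rightarrow> ('v \<Rightarrow> 'v) \<Rightarrow>
     ('v \<times> 'v \<Rightarrow>\<^sub>0 'k) set \<Rightarrow> ('v \<times> 'v \<Rightarrow>\<^sub>0 'k) set" where
  "tensor_map scale f g t = (\<Union>u\<in>t. tensor2 scale (free_map2 f g u))"

definition free_mult2 ::
    "('v::times \<times> 'v \<Rightarrow>\<^sub>0 'k::field) \<Rightarrow> ('v \<times> 'v \<Rightarrow>\<^sub>0 'k) \<Rightarrow> ('v \<times> 'v \<Rightarrow>\<^sub>0 'k)" where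
  "free_mult2 u v =
     lin_ext free_scale (\<lambda>(a, b). lin_ext free_scale (\<lambda>(c, d). basis (a * c, b * d)) v) u"

section \<open>Hopf algebras\<close>

locale unital_algebra = vector_space scale
  for scale :: "'k::field \<Rightarrow> 'h::ring_1 \<Rightarrow> 'h" +
  assumes scale_mult_left: "scale c (x * y) = scale c x * y"
    and scale_mult_right: "scale c (x * y) = x * scale c y"

text \<open>A representative \<open>u \<in> comul x\<close> is a formal sum written \<open>x\<^sub>(\<^sub>1\<^sub>) \<otimes> x\<^sub>(\<^sub>2\<^sub>)\<close>
  in Sweedler notation. In \<open>coassoc\<close>, \<open>w\<close> is a choice of such representatives, and the
  two sides are \<open>(\<Delta> \<otimes> id) (\<Delta> x)\<close> and \<open>(id \<otimes> \<Delta>) (\<Delta> x)\<close>.\<close>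

locale hopf_algebra = unital_algebra scale
  for scale :: "'k::field \<Rightarrow> 'h::ring_1 \<Rightarrow> 'h" +
  fixes comul :: "'h \<Rightarrow> ('h \<times> 'h \<Rightarrow>\<^sub>0 'k) set"
    and counit :: "'h \<Rightarrow> 'k"
    and antipode :: "'h \<Rightarrow> 'h"
  assumes comul_tensor: "comul x \<in> tensor_square scale"
    and comul_add: "u \<in> comul x \<Longrightarrow> v \<in> comul y \<Longrightarrow> u + v \<in> comul (x + y)"
    and comul_scale: "u \<in> comul x \<Longrightarrow> free_scale c u \<in> comul (scale c x)"
    and comul_mult: "u \<in> comul x \<Longrightarrow> v \<in> comul y \<Longrightarrow> free_mult2 u v \<in> comul (x * y)"
    and comul_one: "basis (1, 1) \<in> comul 1"
    and coassoc: "u \<in> comul x \<Longrightarrow> (\<And>a. w a \<in> comul a) \<Longrightarrow>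
      (lin_ext free_scale (\<lambda>(a, b). lin_ext free_scale (\<lambda>(c, d). basis (c, d, b)) (w a)) u,
       lin_ext free_scale (\<lambda>(a, b). lin_ext free_scale (\<lambda>(c, d). basis (a, c, d)) (w b)) u)
      \<in> tensor3_rel scale"
    and counit_linear: "Vector_Spaces.linear scale (*) counit"
    and counit_mult: "counit (x * y) = counit x * counit y"
    and counit_one: "counit 1 = 1"
    and counit_left: "u \<in> comul x \<Longrightarrow> lin_ext scale (\<lambda>(a, b). scale (counit a) b) u = x"
    and counit_right: "u \<in> comul x \<Longrightarrow> lin_ext scale (\<lambda>(a, b). scale (counit b) a) u = x"
    and antipode_linear: "Vector_Spaces.linear scale scale antipode"
    and antipode_left:
      "u \<in> comul x \<Longrightarrow> lin_ext scale (\<lambda>(a, b). antipode a * b) u = scale (counit x) 1"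
    and antipode_right:
      "u \<in> comul x \<Longrightarrow> lin_ext scale (\<lambda>(a, b). a * antipode b) u = scale (counit x) 1"

definition left_integral ::
    "('k \<Rightarrow> 'h::ring_1 \<Rightarrow> 'h) \<Rightarrow> ('h \<Rightarrow> 'k::field) \<Rightarrow> 'h \<Rightarrow> bool" where
  "left_integral scale counit \<Lambda> \<longleftrightarrow> (\<forall>h. h * \<Lambda> = scale (counit h) \<Lambda>)"

definition right_integral ::
    "('k \<Rightarrow> 'h::ring_1 \<Rightarrow> 'h) \<Rightarrow> ('h \<Rightarrow> 'k::field) \<Rightarrow> 'h \<Rightarrow> bool" where
  "right_integral scale counit \<Lambda> \<longleftrightarrow> (\<forall>h. \<Lambda> * h = scale (counit h) \<Lambda>)"

section \<open>Wedderburn decompositions and Casimir elements\<close>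

text \<open>An isomorphism \<open>\<phi>\<close> of algebras from \<open>H\<close> onto the product of the full matrix algebras of
  sizes \<open>n 1, \<dots>, n s\<close> over the ground field; \<open>H\<close> is split semisimple iff there is one.\<close>

locale wedderburn_decomposition = unital_algebra scale
  for scale :: "'k::field \<Rightarrow> 'h::ring_1 \<Rightarrow> 'h" +
  fixes s :: nat and n :: "nat \<Rightarrow> nat" and \<phi> :: "'h \<Rightarrow> nat \<Rightarrow> 'k mat"
  assumes size_pos: "i \<in> {1..s} \<Longrightarrow> n i \<ge> 1"
    and bij: "bij_betw \<phi> UNIV (\<Pi>\<^sub>E i\<in>{1..s}. carrier_mat (n i) (n i))"
    and map_add: "i \<in> {1..s} \<Longrightarrow> \<phi> (x + y) i = \<phi> x i + \<phi> y i"
    and map_scale: "i \<in> {1..s} \<Longrightarrow> \<phi> (scale c x) i = c \<cdot>\<^sub>m \<phi> x i"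
    and map_mult: "i \<in> {1..s} \<Longrightarrow> \<phi> (x * y) i = \<phi> x i * \<phi> y i"
    and map_one: "i \<in> {1..s} \<Longrightarrow> \<phi> 1 i = 1\<^sub>m (n i)"

definition factor_inclusion ::
    "nat \<Rightarrow> (nat \<Rightarrow> nat) \<Rightarrow> ('h \<Rightarrow> nat \<Rightarrow> 'k::field mat) \<Rightarrow> nat \<Rightarrow> 'k mat \<Rightarrow> 'h" where
  "factor_inclusion s n \<phi> i P =
     inv_into UNIV \<phi> (\<lambda>j\<in>{1..s}. if j = i then P else 0\<^sub>m (n j) (n j))"

definition matrix_unit :: "nat \<Rightarrow> nat \<Rightarrow> nat \<Rightarrow> 'k::field mat" where
  "matrix_unit m k l = mat m m (\<lambda>(p, q). if p = k \<and> q = l then 1 else 0)"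

text \<open>Matrices are indexed from 0. The following are representing formal sums.\<close>

definition matrix_casimir :: "nat \<Rightarrow> ('k mat \<times> 'k mat \<Rightarrow>\<^sub>0 'k::field)" where
  "matrix_casimir m = (\<Sum>k<m. \<Sum>l<m. basis (matrix_unit m k l, matrix_unit m l k))"

definition factor_casimir ::
    "nat \<Rightarrow> (nat \<Rightarrow> nat) \<Rightarrow> ('h \<Rightarrow> nat \<Rightarrow> 'k::field mat) \<Rightarrow> nat \<Rightarrow> ('h \<times> 'h \<Rightarrow>\<^sub>0 'k)" where
  "factor_casimir s n \<phi> i =
     free_map2 (factor_inclusion s n \<phi> i) (factor_inclusion s n \<phi> i) (matrix_casimir (n i))"

end

theory Submission
  imports Defs
begin

text \<open>Write the Casimir element \<open>C = \<Lambda>\<^sub>(\<^sub>1\<^sub>) \<otimes> S(\<Lambda>\<^sub>(\<^sub>2\<^sub>))\<close> in the basis of matrix units \<open>E\<^sub>i\<^sub>k\<^sub>l\<close> on its left leg.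
  As \<open>\<Lambda>\<close> is a left integral, \<open>h C = C h\<close>, and this forces
  \<open>C = \<Sum> E\<^sub>i\<^sub>k\<^sub>l A\<^sub>i \<otimes> E\<^sub>i\<^sub>l\<^sub>k\<close> for some matrices \<open>A\<^sub>i\<close>, all of trace
  \<open>\<epsilon>(\<Lambda>) \<noteq> 0\<close> since multiplying the two legs gives \<open>\<epsilon>(\<Lambda>) 1\<close>. So \<open>C\<close> has the form (ii) iff every
  \<open>A\<^sub>i\<close> is scalar, and this amounts to the inner symmetry
  \<open>\<Lambda>\<^sub>(\<^sub>1\<^sub>) h \<otimes> S(\<Lambda>\<^sub>(\<^sub>2\<^sub>)) = \<Lambda>\<^sub>(\<^sub>1\<^sub>) \<otimes> h S(\<Lambda>\<^sub>(\<^sub>2\<^sub>))\<close>. As \<open>\<Lambda>\<close> is also a right integral,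
  \<open>h S(\<Lambda>\<^sub>(\<^sub>1\<^sub>)) \<otimes> \<Lambda>\<^sub>(\<^sub>2\<^sub>) = S(\<Lambda>\<^sub>(\<^sub>1\<^sub>)) \<otimes> \<Lambda>\<^sub>(\<^sub>2\<^sub>) h\<close>; applying \<open>S \<otimes> S\<close> to it gives the inner
  symmetry if \<open>S\<^sup>2 = id\<close>. Conversely, together with the inner symmetry it gives
  \<open>S\<^sup>2(x) S(h) = S\<^sup>2(x S(h))\<close> by nondegeneracy of \<open>C\<close>, hence \<open>S = S\<^sup>3\<close>, and \<open>S\<close> is surjective because
  the right leg of \<open>C\<close> spans \<open>H\<close>.\<close>

section \<open>Linear extension and tensors\<close>

lemma lin_ext_cong: "(\<And>a. f a = g a) \<Longrightarrow> lin_ext sc f u = lin_ext sc g u"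
  by (simp add: lin_ext_def)

lemma linear_lin_ext_commute:
  assumes "Vector_Spaces.linear s1 s2 T"
  shows "T (lin_ext s1 f u) = lin_ext s2 (\<lambda>a. T (f a)) u"
proof -
  interpret Vector_Spaces.linear s1 s2 T by fact
  show ?thesis by (simp add: lin_ext_def sum scale)
qed

context vector_space
begin

lemma linear_lin_ext: "Vector_Spaces.linear free_scale scale (lin_ext scale f)"
proof -
  \<comment> \<open>The support of a sum can be smaller than the union of the supports, so all terms
    are summed over one common finite superset.\<close>
  have superset: "lin_ext scale f u = (\<Sum>a\<in>A. scale (Poly_Mapping.lookup u a) (f a))"
    if "finite A" "Poly_Mapping.keys u \<subseteq> A" for u A
    unfolding lin_ext_def
    by (rule sum.mono_neutral_left) (use that in \<open>auto simp: in_keys_iff\<close>)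
  show ?thesis
    unfolding Vector_Spaces.linear_iff
  proof (intro conjI allI vector_space_axioms free.vector_space_axioms)
    fix u v :: "'c \<Rightarrow>\<^sub>0 'a"
    let ?A = "Poly_Mapping.keys u \<union> Poly_Mapping.keys v"
    have "Poly_Mapping.keys (u + v) \<subseteq> ?A" by (rule Poly_Mapping.keys_add)
    then show "lin_ext scale f (u + v) = lin_ext scale f u + lin_ext scale f v"
      by (simp add: superset[of ?A] lookup_add scale_left_distrib sum.distrib)
  next
    fix c and u :: "'c \<Rightarrow>\<^sub>0 'a"
    have "Poly_Mapping.keys (free_scale c u) \<subseteq> Poly_Mapping.keys u"
      by (auto simp: in_keys_iff)
    then show "lin_ext scale f (free_scale c u) = scale c (lin_ext scale f u)"
      by (simp add: superset[of "Poly_Mapping.keys u"] scale_sum_right)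
  qed
qed

lemma
  shows lin_ext_diff: "lin_ext scale f (u - v) = lin_ext scale f u - lin_ext scale f v"
    and lin_ext_sum: "lin_ext scale f (\<Sum>i\<in>I. w i) = (\<Sum>i\<in>I. lin_ext scale f (w i))"
    and lin_ext_free_scale: "lin_ext scale f (free_scale c u) = scale c (lin_ext scale f u)"
proof -
  interpret Vector_Spaces.linear free_scale scale "lin_ext scale f" by (rule linear_lin_ext)
  show "lin_ext scale f (u - v) = lin_ext scale f u - lin_ext scale f v" by (rule diff)
  show "lin_ext scale f (\<Sum>i\<in>I. w i) = (\<Sum>i\<in>I. lin_ext scale f (w i))" by (rule sum)
  show "lin_ext scale f (free_scale c u) = scale c (lin_ext scale f u)" by (rule scale)
qed

lemma lin_ext_basis [simp]: "lin_ext scale f (basis a) = f a"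
  by (simp add: lin_ext_def)

lemma lin_ext_lin_ext:
  "lin_ext scale f (lin_ext free_scale g u) = lin_ext scale (\<lambda>a. lin_ext scale f (g a)) u"
  by (rule linear_lin_ext_commute[OF linear_lin_ext])

lemma lin_ext_free_map2:
  "lin_ext scale f (free_map2 g h u) = lin_ext scale (\<lambda>(a, b). f (g a, h b)) u"
  unfolding free_map2_def lin_ext_lin_ext by (rule lin_ext_cong) (simp split: prod.split)

end

lemma lin_ext_swap:
  assumes "vector_space sc"
  shows "lin_ext sc (\<lambda>a. lin_ext sc (\<lambda>b. f a b) v) u = lin_ext sc (\<lambda>b. lin_ext sc (\<lambda>a. f a b) u) v"
proof -
  interpret vector_space sc by fact
  show ?thesis
    unfolding lin_ext_def scale_sum_right
    by (subst sum.swap) (simp add: mult.commute)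
qed

lemma linear_zero_on_span:
  assumes "Vector_Spaces.linear s1 s2 T" "\<And>r. r \<in> R \<Longrightarrow> T r = 0" "x \<in> module.span s1 R"
  shows "T x = 0"
proof -
  interpret Vector_Spaces.linear s1 s2 T by fact
  show ?thesis using assms(2,3) by (rule eq_0_on_span)
qed

section \<open>Multilinear maps on H and their factorization through the tensor powers\<close>

context unital_algebra
begin

abbreviation endo :: "('h \<Rightarrow> 'h) \<Rightarrow> bool" where
  "endo \<equiv> Vector_Spaces.linear scale scale"

text \<open>All maps have values in H; contracting the left leg with a linear functional
  \<open>g\<close> fits in as the bilinear map sending \<open>x\<close> and \<open>y\<close> to
  \<open>scale (g x) y\<close>.\<close>

definition bilin :: "('h \<Rightarrow> 'h \<Rightarrow> 'h) \<Rightarrow> bool" where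
  "bilin F \<longleftrightarrow> (\<forall>x. endo (F x)) \<and> (\<forall>y. endo (\<lambda>x. F x y))"

definition trilin :: "('h \<Rightarrow> 'h \<Rightarrow> 'h \<Rightarrow> 'h) \<Rightarrow> bool" where
  "trilin F \<longleftrightarrow> (\<forall>x. bilin (F x)) \<and> (\<forall>y z. endo (\<lambda>x. F x y z))"

lemma endoI:
  assumes "\<And>x y. T (x + y) = T x + T y" "\<And>c x. T (scale c x) = scale c (T x)"
  shows "endo T"
  using assms by (simp add: Vector_Spaces.linear_iff vector_space_axioms)

lemma endoD:
  assumes "endo T"
  shows "T (x + y) = T x + T y" "T (scale c x) = scale c (T x)"
  using assms by (auto simp: Vector_Spaces.linear_iff)

lemma bilinI:
  assumes "\<And>x x' y. F (x + x') y = F x y + F x' y" "\<And>x y y'. F x (y + y') = F x y + F x y'"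
    "\<And>c x y. F (scale c x) y = scale c (F x y)" "\<And>c x y. F x (scale c y) = scale c (F x y)"
  shows "bilin F"
  using assms unfolding bilin_def by (auto intro!: endoI)

lemma bilinD:
  assumes "bilin F"
  shows "F (x + x') y = F x y + F x' y" "F x (y + y') = F x y + F x y'"
    "F (scale c x) y = scale c (F x y)" "F x (scale c y) = scale c (F x y)"
  using assms unfolding bilin_def by (auto simp: Vector_Spaces.linear_iff)

lemma trilinI:
  assumes "\<And>x x' y z. F (x + x') y z = F x y z + F x' y z"
    "\<And>x y y' z. F x (y + y') z = F x y z + F x y' z"
    "\<And>x y z z'. F x y (z + z') = F x y z + F x y z'"
    "\<And>c x y z. F (scale c x) y z = scale c (F x y z)"
    "\<And>c x y z. F x (scale c y) z = scale c (F x y z)"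
    "\<And>c x y z. F x y (scale c z) = scale c (F x y z)"
  shows "trilin F"
  using assms unfolding trilin_def by (auto intro!: endoI bilinI)

lemma trilinD:
  assumes "trilin F"
  shows "F (x + x') y z = F x y z + F x' y z" "F x (y + y') z = F x y z + F x y' z"
    "F x y (z + z') = F x y z + F x y z'" "F (scale c x) y z = scale c (F x y z)"
    "F x (scale c y) z = scale c (F x y z)" "F x y (scale c z) = scale c (F x y z)"
  using assms unfolding trilin_def bilin_def by (auto simp: Vector_Spaces.linear_iff)

text \<open>A bilinear map sends each bilinearity relation to 0, hence also their span; so its
  extension to formal sums is well defined on cosets.\<close>

lemma tensor2_rel_lin_ext:
  assumes "(u, v) \<in> tensor2_rel scale" "bilin F"
  shows "lin_ext scale (\<lambda>(a, b). F a b) u = lin_ext scale (\<lambda>(a, b). F a b) v"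
proof -
  have "lin_ext scale (\<lambda>(a, b). F a b) (u - v) = 0"
    by (rule linear_zero_on_span[OF linear_lin_ext])
      (use assms in \<open>auto simp: tensor2_rel_def bilinear_relations_def lin_ext_diff
        lin_ext_free_scale bilinD[OF assms(2)]\<close>)
  then show ?thesis by (simp add: lin_ext_diff)
qed

lemma tensor3_rel_lin_ext:
  assumes "(u, v) \<in> tensor3_rel scale" "trilin F"
  shows "lin_ext scale (\<lambda>(a, b, c). F a b c) u = lin_ext scale (\<lambda>(a, b, c). F a b c) v"
proof -
  have "lin_ext scale (\<lambda>(a, b, c). F a b c) (u - v) = 0"
    by (rule linear_zero_on_span[OF linear_lin_ext])
      (use assms in \<open>auto simp: tensor3_rel_def trilinear_relations_def lin_ext_diff
        lin_ext_free_scale trilinD[OF assms(2)]\<close>)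
  then show ?thesis by (simp add: lin_ext_diff)
qed

end

section \<open>Sweedler sums\<close>

context hopf_algebra
begin

lemma counit_add [simp]: "counit (x + y) = counit x + counit y"
  and counit_scale [simp]: "counit (scale c x) = c * counit x"
  using counit_linear by (auto simp: Vector_Spaces.linear_iff)

lemmas antipode_add [simp] = endoD(1)[OF antipode_linear]
  and antipode_scale [simp] = endoD(2)[OF antipode_linear]

lemma comul_rel:
  assumes "u \<in> comul x" "v \<in> comul x"
  shows "(u, v) \<in> tensor2_rel scale"
  using comul_tensor[of x] assms equiv_tensor2_rel[of scale] unfolding tensor_square_def
  by (meson quotient_eq_iff)

definition comul_rep :: "'h \<Rightarrow> ('h \<times> 'h \<Rightarrow>\<^sub>0 'k)" where
  "comul_rep x = (SOME u. u \<in> comul x)"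

lemma comul_rep: "comul_rep x \<in> comul x"
proof -
  have "comul x \<noteq> {}"
    using in_quotient_imp_non_empty[OF equiv_tensor2_rel comul_tensor[unfolded tensor_square_def]] .
  then show ?thesis unfolding comul_rep_def by (simp add: some_in_eq)
qed

text \<open>For bilinear \<open>F\<close>, \<open>sweedler F x\<close> is \<open>F x\<^sub>(\<^sub>1\<^sub>) x\<^sub>(\<^sub>2\<^sub>)\<close>; for other \<open>F\<close> it depends on
  the chosen representative of the coproduct.\<close>

definition sweedler :: "('h \<Rightarrow> 'h \<Rightarrow> 'h) \<Rightarrow> 'h \<Rightarrow> 'h" where
  "sweedler F x = lin_ext scale (\<lambda>(a, b). F a b) (comul_rep x)"

lemma sweedler_eq:
  assumes "u \<in> comul x" "bilin F"
  shows "sweedler F x = lin_ext scale (\<lambda>(a, b). F a b) u"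
  unfolding sweedler_def by (rule tensor2_rel_lin_ext[OF comul_rel[OF comul_rep assms(1)] assms(2)])

text \<open>\<open>comul_rep x\<close> is one fixed formal sum, so linearity in \<open>F\<close>
  holds for every \<open>F\<close>. Bilinearity enters when the representative or the argument
  \<open>x\<close> changes.\<close>

lemma sweedler_add [simp]: "sweedler (\<lambda>a b. F a b + G a b) x = sweedler F x + sweedler G x"
  by (simp add: sweedler_def lin_ext_def scale_right_distrib sum.distrib case_prod_unfold)

lemma sweedler_scale [simp]: "sweedler (\<lambda>a b. scale c (F a b)) x = scale c (sweedler F x)"
  by (simp add: sweedler_def lin_ext_def scale_sum_right mult.commute case_prod_unfold)

lemma sweedler_zero [simp]: "sweedler (\<lambda>a b. 0) x = 0"
  using sweedler_scale[of 0 "\<lambda>_ _. 0" x] by simp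

lemma sweedler_swap:
  "sweedler (\<lambda>a b. sweedler (\<lambda>c d. F a b c d) y) x =
    sweedler (\<lambda>c d. sweedler (\<lambda>a b. F a b c d) x) y"
  unfolding sweedler_def case_prod_unfold
  by (rule lin_ext_swap[OF vector_space_axioms])

lemma linear_sweedler: "endo T \<Longrightarrow> T (sweedler F x) = sweedler (\<lambda>a b. T (F a b)) x"
  unfolding sweedler_def by (simp add: linear_lin_ext_commute case_prod_unfold)

lemma sweedler_arg_scale:
  assumes "bilin F"
  shows "sweedler F (scale c x) = scale c (sweedler F x)"
  using sweedler_eq[OF comul_scale[OF comul_rep] assms]
  by (simp add: lin_ext_free_scale sweedler_def)

lemma sweedler_mult:
  assumes "bilin F"
  shows "sweedler F (x * y) = sweedler (\<lambda>a b. sweedler (\<lambda>c d. F (a * c) (b * d)) y) x"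
  using sweedler_eq[OF comul_mult[OF comul_rep comul_rep] assms]
  by (simp add: free_mult2_def lin_ext_lin_ext sweedler_def case_prod_unfold)

lemma sweedler_one: "bilin F \<Longrightarrow> sweedler F 1 = F 1 1"
  by (simp add: sweedler_eq[OF comul_one])

lemma sweedler_coassoc:
  assumes "trilin F"
  shows "sweedler (\<lambda>a b. sweedler (\<lambda>c d. F c d b) a) x =
    sweedler (\<lambda>a b. sweedler (\<lambda>c d. F a c d) b) x"
  using tensor3_rel_lin_ext[OF coassoc[OF comul_rep comul_rep] assms, of x]
  by (simp add: lin_ext_lin_ext sweedler_def case_prod_unfold)

text \<open>This and the next three lemmas put the counit and antipode axioms under an outer linear
  map \<open>T\<close>, so that they apply inside a larger expression.\<close>

lemma sweedler_counit_left:
  assumes "endo T"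
  shows "sweedler (\<lambda>a b. scale (counit a) (T b)) x = T x"
proof -
  have "T (sweedler (\<lambda>a b. scale (counit a) b) x) = T x"
    using counit_left[OF comul_rep, of x] by (simp add: sweedler_def endoD(2)[OF assms])
  then show ?thesis by (simp add: linear_sweedler[OF assms] endoD(2)[OF assms])
qed

lemma sweedler_counit_right:
  assumes "endo T"
  shows "sweedler (\<lambda>a b. scale (counit b) (T a)) x = T x"
proof -
  have "T (sweedler (\<lambda>a b. scale (counit b) a) x) = T x"
    using counit_right[OF comul_rep, of x] by (simp add: sweedler_def endoD(2)[OF assms])
  then show ?thesis by (simp add: linear_sweedler[OF assms] endoD(2)[OF assms])
qed

lemma sweedler_antipode_left:
  assumes "endo T"
  shows "sweedler (\<lambda>a b. T (antipode a * b)) x = scale (counit x) (T 1)"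
proof -
  have "T (sweedler (\<lambda>a b. antipode a * b) x) = scale (counit x) (T 1)"
    using antipode_left[OF comul_rep, of x] by (simp add: sweedler_def endoD(2)[OF assms])
  then show ?thesis by (simp add: linear_sweedler[OF assms] endoD(2)[OF assms])
qed

lemma sweedler_antipode_right:
  assumes "endo T"
  shows "sweedler (\<lambda>a b. T (a * antipode b)) x = scale (counit x) (T 1)"
proof -
  have "T (sweedler (\<lambda>a b. a * antipode b) x) = scale (counit x) (T 1)"
    using antipode_right[OF comul_rep, of x] by (simp add: sweedler_def endoD(2)[OF assms])
  then show ?thesis by (simp add: linear_sweedler[OF assms] endoD(2)[OF assms])
qed

text \<open>Pulling scalars and sums out of products settles, with additivity of the maps involved,
  the multilinearity side conditions below.\<close>

lemmas push_scale = scale_mult_left[symmetric] scale_mult_right[symmetric] scale_right_distrib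
  distrib_left distrib_right

lemma antipode_one: "antipode 1 = 1"
proof -
  have "bilin (\<lambda>a b. antipode a * b)"
    by (rule bilinI) (simp_all add: push_scale)
  from sweedler_one[OF this] show ?thesis
    using sweedler_antipode_left[of "\<lambda>a. a" 1] by (simp add: endoI counit_one)
qed

section \<open>The antipode is an antihomomorphism\<close>

text \<open>\<open>(x, y) \<mapsto> S (x * y)\<close> and \<open>(x, y) \<mapsto> S y * S x\<close> are a left and a right convolution inverse
  of the multiplication; the triple convolution product \<open>M\<close> is evaluated in two ways.\<close>

lemma antipode_mult: "antipode (x * y) = antipode y * antipode x"
proof -
  define M where "M x1 x2 x3 y1 y2 y3 =
    antipode (x1 * y1) * (x2 * (y2 * antipode y3) * antipode x3)" for x1 x2 x3 y1 y2 y3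
  have tri_y: "trilin (M x1 x2 x3)" for x1 x2 x3
    unfolding M_def by (rule trilinI) (simp_all add: push_scale)
  have tri_x: "trilin (\<lambda>x1 x2 x3. sweedler (\<lambda>b y3. sweedler (\<lambda>y1 y2. M x1 x2 x3 y1 y2 y3) b) y)"
    unfolding M_def by (rule trilinI) (simp_all add: push_scale)
  \<comment> \<open>The bracketing is mixed, \<open>x\<close> to the right and \<open>y\<close> to
    the left, so each of the two evaluations rebrackets only one of them.\<close>
  let ?L = "sweedler (\<lambda>x1 a. sweedler (\<lambda>x2 x3.
    sweedler (\<lambda>b y3. sweedler (\<lambda>y1 y2. M x1 x2 x3 y1 y2 y3) b) y) a) x"
  have "?L = sweedler (\<lambda>x1 a. sweedler (\<lambda>x2 x3.
    sweedler (\<lambda>y1 b. sweedler (\<lambda>y2 y3. M x1 x2 x3 y1 y2 y3) b) y) a) x"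
    by (simp add: sweedler_coassoc[OF tri_y])
  also have "\<dots> = sweedler (\<lambda>x1 a. sweedler (\<lambda>x2 x3.
    sweedler (\<lambda>y1 b. scale (counit b) (antipode (x1 * y1) * (x2 * antipode x3))) y) a) x"
  proof -
    have "sweedler (\<lambda>y2 y3. M x1 x2 x3 y1 y2 y3) b =
        scale (counit b) (antipode (x1 * y1) * (x2 * antipode x3))" for x1 x2 x3 y1 b
      unfolding M_def
      using sweedler_antipode_right[of "\<lambda>t. antipode (x1 * y1) * (x2 * t * antipode x3)" b]
      by (simp add: endoI push_scale)
    then show ?thesis by simp
  qed
  also have "\<dots> = sweedler (\<lambda>x1 a. sweedler (\<lambda>x2 x3. antipode (x1 * y) * (x2 * antipode x3)) a) x"
  proof -
    have "sweedler (\<lambda>y1 b. scale (counit b) (antipode (x1 * y1) * (x2 * antipode x3))) y =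
        antipode (x1 * y) * (x2 * antipode x3)" for x1 x2 x3
      by (rule sweedler_counit_right[of "\<lambda>y1. antipode (x1 * y1) * (x2 * antipode x3)"])
        (rule endoI; simp add: push_scale)
    then show ?thesis by simp
  qed
  also have "\<dots> = sweedler (\<lambda>x1 a. scale (counit a) (antipode (x1 * y))) x"
  proof -
    have "sweedler (\<lambda>x2 x3. antipode (x1 * y) * (x2 * antipode x3)) a =
        scale (counit a) (antipode (x1 * y))" for x1 a
      using sweedler_antipode_right[of "\<lambda>t. antipode (x1 * y) * t" a]
      by (simp add: endoI push_scale)
    then show ?thesis by simp
  qed
  also have "\<dots> = antipode (x * y)"
    by (rule sweedler_counit_right[of "\<lambda>x1. antipode (x1 * y)"])
      (rule endoI; simp add: push_scale)
  finally have L: "?L = antipode (x * y)" .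
  have "?L = sweedler (\<lambda>a x3. sweedler (\<lambda>x1 x2.
    sweedler (\<lambda>b y3. sweedler (\<lambda>y1 y2. M x1 x2 x3 y1 y2 y3) b) y) a) x"
    by (rule sweedler_coassoc[OF tri_x, symmetric])
  also have "\<dots> = sweedler (\<lambda>a x3. sweedler (\<lambda>b y3. sweedler (\<lambda>x1 x2.
    sweedler (\<lambda>y1 y2. M x1 x2 x3 y1 y2 y3) b) a) y) x"
    by (subst sweedler_swap) (rule refl)
  also have "\<dots> = sweedler (\<lambda>a x3. sweedler (\<lambda>b y3.
    scale (counit a * counit b) (antipode y3 * antipode x3)) y) x"
  proof -
    have "sweedler (\<lambda>x1 x2. sweedler (\<lambda>y1 y2. M x1 x2 x3 y1 y2 y3) b) a =
        scale (counit a * counit b) (antipode y3 * antipode x3)" for x3 y3 a b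
    proof -
      \<comment> \<open>Multiplicativity of the coproduct, read backwards, turns the double sum over
        \<open>a\<close> and \<open>b\<close> into one sum over \<open>a * b\<close>, where the
        antipode axiom applies.\<close>
      have "bilin (\<lambda>p q. antipode p * q * (antipode y3 * antipode x3))"
        by (rule bilinI) (simp_all add: push_scale)
      from sweedler_mult[OF this]
      have "sweedler (\<lambda>x1 x2. sweedler (\<lambda>y1 y2. M x1 x2 x3 y1 y2 y3) b) a =
          sweedler (\<lambda>p q. antipode p * q * (antipode y3 * antipode x3)) (a * b)"
        by (simp add: M_def mult.assoc)
      then show ?thesis
        using sweedler_antipode_left[of "\<lambda>t. t * (antipode y3 * antipode x3)" "a * b"]
        by (simp add: endoI push_scale counit_mult)
    qed
    then show ?thesis by simp
  qed
  also have "\<dots> = sweedler (\<lambda>a x3. scale (counit a) (antipode y * antipode x3)) x"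
  proof -
    have "sweedler (\<lambda>b y3. scale (counit a * counit b) (antipode y3 * antipode x3)) y =
        scale (counit a) (antipode y * antipode x3)" for a x3
      using sweedler_counit_left[of "\<lambda>t. scale (counit a) (antipode t * antipode x3)" y]
      by (simp add: endoI push_scale mult.commute)
    then show ?thesis by simp
  qed
  also have "\<dots> = antipode y * antipode x"
    by (rule sweedler_counit_left[of "\<lambda>t. antipode y * antipode t"])
      (rule endoI; simp add: push_scale)
  finally show ?thesis using L by simp
qed

section \<open>Integrals\<close>

text \<open>\<open>M\<close> collapses in two ways: \<open>antipode h2 * h3\<close> cancels by the
  antipode axiom, while \<open>antipode b * antipode h2 = antipode (h2 * b)\<close> leaves the
  coproduct of an element times \<open>\<Lambda>\<close>, which the left integral absorbs.
  Coassociativity equates the results.\<close>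

lemma left_integral_casimir:
  assumes "left_integral scale counit \<Lambda>" "bilin F"
  shows "sweedler (\<lambda>a b. F (h * a) (antipode b)) \<Lambda> = sweedler (\<lambda>a b. F a (antipode b * h)) \<Lambda>"
proof -
  define M where "M h1 h2 h3 = sweedler (\<lambda>a b. F (h1 * a) (antipode b * (antipode h2 * h3))) \<Lambda>"
    for h1 h2 h3
  note F = bilinD[OF assms(2)]
  have tri: "trilin M"
    unfolding M_def by (rule trilinI) (simp_all add: push_scale F)
  have "sweedler (\<lambda>h1 a. sweedler (\<lambda>h2 h3. M h1 h2 h3) a) h =
      sweedler (\<lambda>h1 a. scale (counit a) (sweedler (\<lambda>a b. F (h1 * a) (antipode b)) \<Lambda>)) h"
  proof -
    have "sweedler (\<lambda>h2 h3. M h1 h2 h3) a =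
        scale (counit a) (sweedler (\<lambda>a b. F (h1 * a) (antipode b)) \<Lambda>)" for h1 a
      unfolding M_def
      using sweedler_antipode_left[of "\<lambda>t. sweedler (\<lambda>a b. F (h1 * a) (antipode b * t)) \<Lambda>" a]
      by (simp add: endoI push_scale F)
    then show ?thesis by simp
  qed
  also have "\<dots> = sweedler (\<lambda>a b. F (h * a) (antipode b)) \<Lambda>"
    by (rule sweedler_counit_right[of "\<lambda>h1. sweedler (\<lambda>a b. F (h1 * a) (antipode b)) \<Lambda>"])
      (rule endoI; simp add: push_scale F)
  finally have 1: "sweedler (\<lambda>h1 a. sweedler (\<lambda>h2 h3. M h1 h2 h3) a) h =
    sweedler (\<lambda>a b. F (h * a) (antipode b)) \<Lambda>" .
  have "sweedler (\<lambda>a h3. sweedler (\<lambda>h1 h2. M h1 h2 h3) a) h =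
      sweedler (\<lambda>a h3. scale (counit a) (sweedler (\<lambda>a b. F a (antipode b * h3)) \<Lambda>)) h"
  proof -
    have "sweedler (\<lambda>h1 h2. M h1 h2 h3) a =
        scale (counit a) (sweedler (\<lambda>a b. F a (antipode b * h3)) \<Lambda>)" for h3 a
    proof -
      have bi: "bilin (\<lambda>a b. F a (antipode b * h3))"
        by (rule bilinI) (simp_all add: push_scale F)
      have "sweedler (\<lambda>h1 h2. M h1 h2 h3) a = sweedler (\<lambda>a b. F a (antipode b * h3)) (a * \<Lambda>)"
        by (simp add: sweedler_mult[OF bi] M_def antipode_mult mult.assoc)
      also have "a * \<Lambda> = scale (counit a) \<Lambda>"
        using assms(1) by (simp add: left_integral_def)
      finally show ?thesis by (simp add: sweedler_arg_scale[OF bi])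
    qed
    then show ?thesis by simp
  qed
  also have "\<dots> = sweedler (\<lambda>a b. F a (antipode b * h)) \<Lambda>"
    by (rule sweedler_counit_left[of "\<lambda>h3. sweedler (\<lambda>a b. F a (antipode b * h3)) \<Lambda>"])
      (rule endoI; simp add: push_scale F)
  finally show ?thesis using 1 sweedler_coassoc[OF tri, of h] by simp
qed

text \<open>The mirror image, with the antipode on the left leg: either
  \<open>h1 * antipode h2\<close> cancels, or
  \<open>antipode h2 * antipode a = antipode (a * h2)\<close> produces the coproduct of
  \<open>\<Lambda>\<close> times an element.\<close>

lemma right_integral_casimir:
  assumes "right_integral scale counit \<Lambda>" "bilin F"
  shows "sweedler (\<lambda>a b. F (h * antipode a) b) \<Lambda> = sweedler (\<lambda>a b. F (antipode a) (b * h)) \<Lambda>"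
proof -
  define M where "M h1 h2 h3 = sweedler (\<lambda>a b. F (h1 * antipode h2 * antipode a) (b * h3)) \<Lambda>"
    for h1 h2 h3
  note F = bilinD[OF assms(2)]
  have tri: "trilin M"
    unfolding M_def by (rule trilinI) (simp_all add: push_scale F)
  have "sweedler (\<lambda>a h3. sweedler (\<lambda>h1 h2. M h1 h2 h3) a) h =
      sweedler (\<lambda>a h3. scale (counit a) (sweedler (\<lambda>a b. F (antipode a) (b * h3)) \<Lambda>)) h"
  proof -
    have "sweedler (\<lambda>h1 h2. M h1 h2 h3) a =
        scale (counit a) (sweedler (\<lambda>a b. F (antipode a) (b * h3)) \<Lambda>)" for h3 a
      unfolding M_def
      using sweedler_antipode_right[of "\<lambda>t. sweedler (\<lambda>a b. F (t * antipode a) (b * h3)) \<Lambda>" a]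
      by (simp add: endoI push_scale F)
    then show ?thesis by simp
  qed
  also have "\<dots> = sweedler (\<lambda>a b. F (antipode a) (b * h)) \<Lambda>"
    by (rule sweedler_counit_left[of "\<lambda>h3. sweedler (\<lambda>a b. F (antipode a) (b * h3)) \<Lambda>"])
      (rule endoI; simp add: push_scale F)
  finally have 1: "sweedler (\<lambda>a h3. sweedler (\<lambda>h1 h2. M h1 h2 h3) a) h =
    sweedler (\<lambda>a b. F (antipode a) (b * h)) \<Lambda>" .
  have "sweedler (\<lambda>h1 a. sweedler (\<lambda>h2 h3. M h1 h2 h3) a) h =
      sweedler (\<lambda>h1 a. scale (counit a) (sweedler (\<lambda>a b. F (h1 * antipode a) b) \<Lambda>)) h"
  proof -
    have "sweedler (\<lambda>h2 h3. M h1 h2 h3) a =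
        scale (counit a) (sweedler (\<lambda>a b. F (h1 * antipode a) b) \<Lambda>)" for h1 a
    proof -
      have bi: "bilin (\<lambda>a b. F (h1 * antipode a) b)"
        by (rule bilinI) (simp_all add: push_scale F)
      have "sweedler (\<lambda>h2 h3. M h1 h2 h3) a = sweedler (\<lambda>a b. F (h1 * antipode a) b) (\<Lambda> * a)"
        unfolding sweedler_mult[OF bi] M_def
        by (subst sweedler_swap) (simp add: antipode_mult mult.assoc)
      also have "\<Lambda> * a = scale (counit a) \<Lambda>"
        using assms(1) by (simp add: right_integral_def)
      finally show ?thesis by (simp add: sweedler_arg_scale[OF bi])
    qed
    then show ?thesis by simp
  qed
  also have "\<dots> = sweedler (\<lambda>a b. F (h * antipode a) b) \<Lambda>"
    by (rule sweedler_counit_right[of "\<lambda>h1. sweedler (\<lambda>a b. F (h1 * antipode a) b) \<Lambda>"])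
      (rule endoI; simp add: push_scale F)
  finally show ?thesis using 1 sweedler_coassoc[OF tri, of h] by simp
qed

end

section \<open>Coordinates\<close>

context unital_algebra
begin

text \<open>Expanding the left legs in the \<open>e i\<close> and collecting the right legs brings
  every formal sum to a normal form \<open>?N u\<close> modulo the relations, and this form depends
  only on the contractions of the left leg.\<close>

lemma tensor2_rel_by_coordinates:
  assumes "finite I"
    and expand: "\<And>x. x = (\<Sum>i\<in>I. scale (c i x) (e i))"
    and eq: "\<And>i. i \<in> I \<Longrightarrow> lin_ext scale (\<lambda>(x, y). scale (c i x) y) u =
      lin_ext scale (\<lambda>(x, y). scale (c i x) y) v"
  shows "(u, v) \<in> tensor2_rel scale"
proof -
  define R where "R = free.span (bilinear_relations scale)"
  note [simp] = free.span_zero[of "bilinear_relations scale", folded R_def]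
  note R_add = free.span_add[of _ "bilinear_relations scale", folded R_def]
    and R_diff = free.span_diff[of _ "bilinear_relations scale", folded R_def]
    and R_sum = free.span_sum[of _ _ "bilinear_relations scale", folded R_def]
    and R_scale = free.span_scale[of _ "bilinear_relations scale", folded R_def]
  have rel: "r \<in> R" if "r \<in> bilinear_relations scale" for r
    unfolding R_def using that by (rule free.span_base)
  have addL: "basis (x + x', y) - basis (x, y) - basis (x', y) \<in> R" for x x' y
    by (rule rel) (unfold bilinear_relations_def, blast)
  have addR: "basis (x, y + y') - basis (x, y) - basis (x, y') \<in> R" for x y y'
    by (rule rel) (unfold bilinear_relations_def, blast)
  have scaleL: "basis (scale a x, y) - free_scale a (basis (x, y)) \<in> R" for a x y
    by (rule rel) (unfold bilinear_relations_def, blast)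
  have scaleR: "basis (x, scale a y) - free_scale a (basis (x, y)) \<in> R" for a x y
    by (rule rel) (unfold bilinear_relations_def, blast)
  have sumL: "basis (\<Sum>i\<in>A. f i, y) - (\<Sum>i\<in>A. basis (f i, y)) \<in> R" if "finite A"
    for A :: "'i set" and f y
    using that
  proof induction
    case empty
    \<comment> \<open>The scaling relation with scalar 0 is \<open>basis (0, y)\<close>
      itself.\<close>
    show ?case using scaleL[of 0 0 y] by simp
  next
    case (insert i A)
    from R_add[OF addL[of "f i" "\<Sum>i\<in>A. f i" y] insert.IH] insert.hyps
    show ?case by (simp add: algebra_simps)
  qed
  have sumR: "basis (x, \<Sum>p\<in>A. f p) - (\<Sum>p\<in>A. basis (x, f p)) \<in> R" if "finite A"
    for A :: "('h \<times> 'h) set" and f x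
    using that
  proof induction
    case empty
    show ?case using scaleR[of x 0 0] by simp
  next
    case (insert i A)
    from R_add[OF addR[of x "f i" "\<Sum>i\<in>A. f i"] insert.IH] insert.hyps
    show ?case by (simp add: algebra_simps)
  qed
  \<comment> \<open>The coefficients of \<open>x\<close> are carried across the tensor sign to the
    right leg.\<close>
  have pure: "basis (x, y) - (\<Sum>i\<in>I. basis (e i, scale (c i x) y)) \<in> R" for x y
  proof -
    have "basis (scale a z, y) - basis (z, scale a y) \<in> R" for a z
      using R_diff[OF scaleL[of a z y] scaleR[of z a y]] by simp
    then have "(\<Sum>i\<in>I. basis (scale (c i x) (e i), y) - basis (e i, scale (c i x) y)) \<in> R"
      by (intro R_sum)
    from R_add[OF sumL[OF assms(1), of "\<lambda>i. scale (c i x) (e i)" y] this]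
    show ?thesis by (simp add: sum_subtractf expand[of x, symmetric])
  qed
  let ?N = "\<lambda>u. \<Sum>i\<in>I. basis (e i, lin_ext scale (\<lambda>(x, y). scale (c i x) y) u)"
  have normal: "u - ?N u \<in> R" for u
  proof -
    let ?K = "Poly_Mapping.keys u"
    let ?t = "\<lambda>i p. scale (Poly_Mapping.lookup u p) (scale (c i (fst p)) (snd p))"
    have "free_scale a (basis p) -
        (\<Sum>i\<in>I. basis (e i, scale a (scale (c i (fst p)) (snd p)))) \<in> R" for a p
    proof -
      have "(\<Sum>i\<in>I. basis (e i, scale a (scale (c i (fst p)) (snd p))) -
          free_scale a (basis (e i, scale (c i (fst p)) (snd p)))) \<in> R"
        by (intro R_sum scaleR)
      from R_diff[OF R_scale[OF pure[of "fst p" "snd p"], of a] this]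
      show ?thesis
        by (simp add: free.scale_right_diff_distrib sum_subtractf free.scale_sum_right
          del: scale_scale)
    qed
    then have 1: "(\<Sum>p\<in>?K. free_scale (Poly_Mapping.lookup u p) (basis p) -
        (\<Sum>i\<in>I. basis (e i, ?t i p))) \<in> R"
      by (intro R_sum)
    \<comment> \<open>Additivity in the right leg collects all terms with the same left leg
      \<open>e i\<close>.\<close>
    have 2: "(\<Sum>i\<in>I. basis (e i, \<Sum>p\<in>?K. ?t i p) - (\<Sum>p\<in>?K. basis (e i, ?t i p))) \<in> R"
      by (intro R_sum sumR) simp
    have u: "u = (\<Sum>p\<in>?K. free_scale (Poly_Mapping.lookup u p) (basis p))"
      by (rule poly_mapping_eqI)
        (simp add: lookup_sum lookup_single when_def in_keys_iff if_distrib[of "(*) _"] cong: if_cong)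
    have N: "?N u = (\<Sum>i\<in>I. basis (e i, \<Sum>p\<in>?K. ?t i p))"
      by (simp add: lin_ext_def case_prod_unfold)
    have "(\<Sum>p\<in>?K. \<Sum>i\<in>I. basis (e i, ?t i p) :: 'h \<times> 'h \<Rightarrow>\<^sub>0 'k) =
        (\<Sum>i\<in>I. \<Sum>p\<in>?K. basis (e i, ?t i p))"
      by (rule sum.swap)
    with R_diff[OF 1 2] show ?thesis
      unfolding N by (simp add: sum_subtractf u[symmetric])
  qed
  have "?N u = ?N v" using eq by simp
  then have "u - v = (u - ?N u) - (v - ?N v)" by (simp add: algebra_simps)
  with R_diff[OF normal[of u] normal[of v]] show ?thesis
    by (simp only: tensor2_rel_def R_def mem_Collect_eq case_prod_conv)
qed

end

section \<open>Matrix units of H and matrix entries as coordinates\<close>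

context wedderburn_decomposition
begin

definition coord :: "nat \<Rightarrow> nat \<Rightarrow> nat \<Rightarrow> 'h \<Rightarrow> 'k" where
  "coord i k l x = \<phi> x i $$ (k, l)"

definition mat_unit :: "nat \<Rightarrow> nat \<Rightarrow> nat \<Rightarrow> 'h" where
  "mat_unit i k l = factor_inclusion s n \<phi> i (matrix_unit (n i) k l)"

definition idx :: "(nat \<times> nat \<times> nat) set" where
  "idx = (SIGMA i:{1..s}. {..<n i} \<times> {..<n i})"

lemma finite_idx: "finite idx"
  by (simp add: idx_def)

lemma mem_idx [simp]: "(i, k, l) \<in> idx \<longleftrightarrow> i \<in> {1..s} \<and> k < n i \<and> l < n i"
  by (auto simp: idx_def)

lemma map_carrier: "i \<in> {1..s} \<Longrightarrow> \<phi> x i \<in> carrier_mat (n i) (n i)"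
  using bij_betwE[OF bij] by (auto simp: PiE_iff)

lemma map_dim:
  assumes "i \<in> {1..s}"
  shows "dim_row (\<phi> x i) = n i" "dim_col (\<phi> x i) = n i"
  using map_carrier[OF assms] by auto

lemma
  assumes "(i, k, l) \<in> idx"
  shows coord_add: "coord i k l (x + y) = coord i k l x + coord i k l y"
    and coord_scale: "coord i k l (scale c x) = c * coord i k l x"
    and coord_mult: "coord i k l (x * y) = (\<Sum>m<n i. coord i k m x * coord i m l y)"
    and coord_one: "coord i k l 1 = (if k = l then 1 else 0)"
  using assms
  by (simp_all add: coord_def map_add map_scale map_mult map_one map_dim scalar_prod_def
      lessThan_atLeast0)

lemma coord_zero:
  assumes "(i, k, l) \<in> idx"
  shows "coord i k l 0 = 0"
  using coord_scale[OF assms, of 0 0] by simp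

lemma coord_sum:
  assumes "(i, k, l) \<in> idx"
  shows "coord i k l (\<Sum>p\<in>A. f p) = (\<Sum>p\<in>A. coord i k l (f p))"
  by (induction A rule: infinite_finite_induct) (simp_all add: coord_add[OF assms] coord_zero[OF assms])

lemma coord_eqI:
  assumes "\<And>i k l. (i, k, l) \<in> idx \<Longrightarrow> coord i k l x = coord i k l y"
  shows "x = y"
proof -
  have "\<phi> x = \<phi> y"
  proof (rule PiE_ext)
    show "\<phi> x \<in> (\<Pi>\<^sub>E i\<in>{1..s}. carrier_mat (n i) (n i))"
      "\<phi> y \<in> (\<Pi>\<^sub>E i\<in>{1..s}. carrier_mat (n i) (n i))"
      using bij_betwE[OF bij] by auto
  next
    fix i assume "i \<in> {1..s}"
    then show "\<phi> x i = \<phi> y i"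
      using assms by (intro eq_matI) (simp_all add: map_dim coord_def)
  qed
  then show ?thesis using bij by (auto simp: bij_betw_def dest: injD)
qed

lemma coord_unit:
  assumes "(j, a, b) \<in> idx" "(i, k, l) \<in> idx"
  shows "coord j a b (mat_unit i k l) = (if (i, k, l) = (j, a, b) then 1 else 0)"
proof -
  let ?P = "\<lambda>j\<in>{1..s}. if j = i then matrix_unit (n i) k l else 0\<^sub>m (n j) (n j)"
  have "?P \<in> (\<Pi>\<^sub>E i\<in>{1..s}. carrier_mat (n i) (n i))"
    by (auto simp: PiE_iff matrix_unit_def extensional_def)
  with bij have "?P \<in> range \<phi>" by (simp add: bij_betw_def)
  then have "\<phi> (mat_unit i k l) = ?P"
    unfolding mat_unit_def factor_inclusion_def by (rule f_inv_into_f)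
  with assms show ?thesis by (auto simp: coord_def matrix_unit_def)
qed

lemma unit_expansion: "x = (\<Sum>(i, k, l)\<in>idx. scale (coord i k l x) (mat_unit i k l))"
proof (rule coord_eqI)
  fix j a b assume j: "(j, a, b) \<in> idx"
  have "coord j a b (\<Sum>(i, k, l)\<in>idx. scale (coord i k l x) (mat_unit i k l)) =
      (\<Sum>p\<in>idx. if p = (j, a, b) then coord j a b x else 0)"
    unfolding coord_sum[OF j]
    by (intro sum.cong refl) (auto simp: coord_scale[OF j] coord_unit[OF j] simp del: mem_idx split: if_splits)
  then show "coord j a b x = coord j a b (\<Sum>(i, k, l)\<in>idx. scale (coord i k l x) (mat_unit i k l))"
    using j finite_idx by (simp del: mem_idx)
qed

lemma tensor2_rel_by_coord:
  assumes "\<And>i k l. (i, k, l) \<in> idx \<Longrightarrow> lin_ext scale (\<lambda>(x, y). scale (coord i k l x) y) u =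
    lin_ext scale (\<lambda>(x, y). scale (coord i k l x) y) v"
  shows "(u, v) \<in> tensor2_rel scale"
  using finite_idx
proof (rule tensor2_rel_by_coordinates)
  show "x = (\<Sum>p\<in>idx. scale ((\<lambda>(i, k, l). coord i k l) p x) ((\<lambda>(i, k, l). mat_unit i k l) p))" for x
    using unit_expansion[of x] by (simp add: case_prod_unfold)
qed (use assms in auto)

lemma coord_mult_unit:
  assumes "(j, a, b) \<in> idx" "(i, k, l) \<in> idx"
  shows "coord j a b (x * mat_unit i k l) = (if j = i \<and> b = l then coord i a k x else 0)"
proof -
  have "coord j a b (x * mat_unit i k l) =
      (\<Sum>m<n j. if m = k then (if j = i \<and> b = l then coord i a k x else 0) else 0)"
    unfolding coord_mult[OF assms(1)]
    by (rule sum.cong) (use assms in \<open>auto simp: coord_unit\<close>)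
  then show ?thesis using assms by auto
qed

lemma coord_unit_mult:
  assumes "(j, a, b) \<in> idx" "(i, k, l) \<in> idx"
  shows "coord j a b (mat_unit i k l * x) = (if j = i \<and> a = k then coord i l b x else 0)"
proof -
  have "coord j a b (mat_unit i k l * x) =
      (\<Sum>m<n j. if m = l then (if j = i \<and> a = k then coord i l b x else 0) else 0)"
    unfolding coord_mult[OF assms(1)]
    by (rule sum.cong) (use assms in \<open>auto simp: coord_unit\<close>)
  then show ?thesis using assms by auto
qed

lemma lin_ext_factor_casimir:
  assumes "bilin F"
  shows "lin_ext scale (\<lambda>(a, b). F a b) (factor_casimir s n \<phi> i) =
    (\<Sum>k<n i. \<Sum>l<n i. F (mat_unit i k l) (mat_unit i l k))"
  by (simp add: factor_casimir_def lin_ext_free_map2 matrix_casimir_def lin_ext_sum mat_unit_def)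

lemma bilin_coord: "(i, k, l) \<in> idx \<Longrightarrow> bilin (\<lambda>x y. scale (coord i k l x) y)"
  by (rule bilinI) (simp_all add: coord_add coord_scale scale_left_distrib scale_right_distrib
    mult.commute del: mem_idx)

text \<open>The value with which \<open>casimir_coord\<close> is later compared: among the terms
  E_ab \<otimes> E_ba of block \<open>j = i\<close> only a = k, b = l survives, whence the
  transposed indices.\<close>

lemma contract_factor_casimir:
  assumes "(i, k, l) \<in> idx" "j \<in> {1..s}"
  shows "lin_ext scale (\<lambda>(x, y). scale (coord i k l x) y) (factor_casimir s n \<phi> j) =
    (if j = i then mat_unit i l k else 0)"
proof -
  have "(\<Sum>b<n j. scale (coord i k l (mat_unit j a b)) (mat_unit j b a)) =
      (if a = k then if j = i then mat_unit i l k else 0 else 0)" if "a < n j" for a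
  proof -
    have "(\<Sum>b<n j. scale (coord i k l (mat_unit j a b)) (mat_unit j b a)) =
        (\<Sum>b<n j. if b = l then (if a = k then if j = i then mat_unit i l k else 0 else 0) else 0)"
      by (rule sum.cong) (use assms that in \<open>auto simp: coord_unit\<close>)
    then show ?thesis using assms by auto
  qed
  then show ?thesis
    using assms by (subst lin_ext_factor_casimir[OF bilin_coord]) auto
qed

end

section \<open>Casimir coordinates\<close>

locale split_hopf_algebra =
  hopf_algebra scale comul counit antipode + wedderburn_decomposition scale s n \<phi>
  for scale :: "'k::field \<Rightarrow> 'h::ring_1 \<Rightarrow> 'h"
    and comul counit antipode and s :: nat and n \<phi>
begin

lemma antipode_sum: "antipode (\<Sum>p\<in>A. f p) = (\<Sum>p\<in>A. antipode (f p))"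
  using antipode_scale[of 0 0] by (induction A rule: infinite_finite_induct) simp_all

lemma sweedler_sum: "sweedler (\<lambda>a b. \<Sum>p\<in>A. F p a b) x = (\<Sum>p\<in>A. sweedler (F p) x)"
  by (induction A rule: infinite_finite_induct) simp_all

lemma linear_functional_expansion:
  assumes "\<And>x y. g (x + y) = g x + g y" "\<And>c x. g (scale c x) = c * g x"
  shows "g x = (\<Sum>(i, k, l)\<in>idx. coord i k l x * g (mat_unit i k l))"
proof -
  have "g (\<Sum>p\<in>A. f p) = (\<Sum>p\<in>A. g (f p))" for A and f :: "nat \<times> nat \<times> nat \<Rightarrow> 'h"
    using assms(2)[of 0 0] by (induction A rule: infinite_finite_induct) (simp_all add: assms(1))
  then have "g (\<Sum>(i, k, l)\<in>idx. scale (coord i k l x) (mat_unit i k l)) =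
      (\<Sum>(i, k, l)\<in>idx. coord i k l x * g (mat_unit i k l))"
    by (simp add: case_prod_unfold assms(2))
  then show ?thesis by (simp add: unit_expansion[symmetric])
qed

text \<open>The counit is the projection onto a factor of size 1; the integrals are the multiples of the
  central idempotent \<open>e\<close> of that factor.\<close>

lemma counit_idempotent:
  obtains e where "counit e = 1" "left_integral scale counit e" "right_integral scale counit e"
proof -
  \<comment> \<open>The sum is the counit of 1, so some term is nonzero, and it comes from a
    diagonal unit because 1 has no other entries.\<close>
  have "(\<Sum>(i, k, l)\<in>idx. coord i k l 1 * counit (mat_unit i k l)) \<noteq> 0"
    using linear_functional_expansion[of counit 1] by (simp add: counit_one)
  then obtain p where p: "p \<in> idx"
      "(case p of (i, k, l) \<Rightarrow> coord i k l 1 * counit (mat_unit i k l)) \<noteq> 0"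
    by (rule sum.not_neutral_contains_not_neutral)
  obtain i k l where "p = (i, k, l)" by (cases p)
  with p have ikl: "(i, k, l) \<in> idx" "coord i k l 1 \<noteq> 0" "counit (mat_unit i k l) \<noteq> 0"
    by auto
  then have "k = l" by (metis coord_one)
  define e where "e = mat_unit i k k"
  have ik: "(i, k, k) \<in> idx" and e: "counit e \<noteq> 0"
    using ikl \<open>k = l\<close> by (simp_all add: e_def)
  \<comment> \<open>Cutting \<open>h\<close> down to \<open>e * h * e\<close> leaves a multiple of
    \<open>e\<close>; multiplicativity then shows that the counit reads off the entry of
    \<open>h\<close> at position (k, k).\<close>
  have corner: "counit e * counit h * counit e = coord i k k h * counit e" for h
  proof -
    have "e * h * e = scale (coord i k k h) e"
      unfolding e_def
      by (rule coord_eqI)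
        (use ik in \<open>auto simp: coord_mult_unit coord_unit_mult coord_scale coord_unit\<close>)
    from arg_cong[OF this, of counit] show ?thesis by (simp add: counit_mult)
  qed
  from corner[of 1] e have e1: "counit e = 1" by (simp add: counit_one coord_one[OF ik])
  with corner have counit_eq: "counit h = coord i k k h" for h by simp
  \<comment> \<open>With a second index, \<open>e\<close> would be a product of two off-diagonal
    units, the first of which has counit 0, against \<open>counit e = 1\<close>.\<close>
  have size: "l = k" if "l < n i" for l
  proof (rule ccontr)
    assume "l \<noteq> k"
    have "mat_unit i k l * mat_unit i l k = e"
      unfolding e_def
      by (rule coord_eqI) (use ik that in \<open>auto simp: coord_mult_unit coord_unit\<close>)
    from arg_cong[OF this, of counit] have "counit (mat_unit i k l) * counit (mat_unit i l k) = 1"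
      by (simp add: counit_mult e1)
    moreover have "counit (mat_unit i k l) = 0"
      using ik that \<open>l \<noteq> k\<close> by (simp add: counit_eq coord_unit)
    ultimately show False by simp
  qed
  show thesis
  proof
    show "counit e = 1" by fact
    have "h * e = scale (counit h) e" for h
      unfolding e_def
      by (rule coord_eqI)
        (use ik in \<open>auto simp: coord_mult_unit coord_scale coord_unit counit_eq dest: size\<close>)
    then show "left_integral scale counit e" by (simp add: left_integral_def)
    have "e * h = scale (counit h) e" for h
      unfolding e_def
      by (rule coord_eqI)
        (use ik in \<open>auto simp: coord_unit_mult coord_scale coord_unit counit_eq dest: size\<close>)
    then show "right_integral scale counit e" by (simp add: right_integral_def)
  qed
qed

lemma integral_two_sided:
  assumes "left_integral scale counit \<Lambda> \<or> right_integral scale counit \<Lambda>" "\<Lambda> \<noteq> 0"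
  shows "left_integral scale counit \<Lambda>" "right_integral scale counit \<Lambda>" "counit \<Lambda> \<noteq> 0"
proof -
  obtain e where e: "counit e = 1" "left_integral scale counit e" "right_integral scale counit e"
    by (rule counit_idempotent)
  \<comment> \<open>If \<open>\<Lambda>\<close> is a left integral, \<open>e * \<Lambda>\<close> is
    both \<open>\<Lambda>\<close> and \<open>scale (counit \<Lambda>) e\<close>; for a right
    integral take \<open>\<Lambda> * e\<close>.\<close>
  have \<Lambda>: "\<Lambda> = scale (counit \<Lambda>) e"
    using assms(1) e by (metis left_integral_def right_integral_def scale_one)
  then show "counit \<Lambda> \<noteq> 0" using assms(2) by auto
  show "left_integral scale counit \<Lambda>"
    unfolding left_integral_def using e(2)
    by (subst (1 2) \<Lambda>) (simp add: left_integral_def scale_mult_right[symmetric] mult.commute)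
  show "right_integral scale counit \<Lambda>"
    unfolding right_integral_def using e(3)
    by (subst (1 2) \<Lambda>) (simp add: right_integral_def scale_mult_left[symmetric] mult.commute)
qed

text \<open>The right leg standing against the unit E_ikl when the left leg of C is expanded in
  matrix units.\<close>

definition casimir_coord :: "'h \<Rightarrow> nat \<Rightarrow> nat \<Rightarrow> nat \<Rightarrow> 'h" where
  "casimir_coord \<Lambda> i k l = sweedler (\<lambda>a b. scale (coord i k l a) (antipode b)) \<Lambda>"

lemma bilin_coord_antipode:
  "(i, k, l) \<in> idx \<Longrightarrow> bilin (\<lambda>x y. scale (coord i k l x) (antipode y))"
  by (rule bilinI) (simp_all add: coord_add coord_scale scale_left_distrib scale_right_distrib
    mult.commute del: mem_idx)

text \<open>Contractions of the left leg determine a tensor, so the equation of cosets in (ii)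
  becomes one equation in H for each matrix unit.\<close>

lemma casimir_tensor_eq_iff:
  "tensor_map scale id antipode (comul \<Lambda>) = tensor2 scale w \<longleftrightarrow>
    (\<forall>(i, k, l)\<in>idx. casimir_coord \<Lambda> i k l = lin_ext scale (\<lambda>(x, y). scale (coord i k l x) y) w)"
  (is "_ \<longleftrightarrow> ?R")
proof -
  have eq: "lin_ext scale (\<lambda>(x, y). scale (coord i k l x) y) (free_map2 id antipode u) =
      casimir_coord \<Lambda> i k l" if "u \<in> comul \<Lambda>" "(i, k, l) \<in> idx" for u i k l
    using sweedler_eq[OF that(1) bilin_coord_antipode[OF that(2)]]
    by (simp add: lin_ext_free_map2 casimir_coord_def)
  have rel: "tensor2 scale u = tensor2 scale v \<longleftrightarrow> (u, v) \<in> tensor2_rel scale" for u v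
    unfolding tensor2_def using equiv_class_eq_iff[OF equiv_tensor2_rel] by auto
  show ?thesis
  proof
    assume tensor: "tensor_map scale id antipode (comul \<Lambda>) = tensor2 scale w"
    have "free_map2 id antipode (comul_rep \<Lambda>) \<in> tensor_map scale id antipode (comul \<Lambda>)"
      unfolding tensor_map_def tensor2_def
      using comul_rep equiv_class_self[OF equiv_tensor2_rel] by blast
    then have "(w, free_map2 id antipode (comul_rep \<Lambda>)) \<in> tensor2_rel scale"
      unfolding tensor by (simp add: tensor2_def)
    from tensor2_rel_lin_ext[OF this bilin_coord] show ?R
      by (auto simp: eq[OF comul_rep] simp del: mem_idx)
  next
    assume R: ?R
    \<comment> \<open>\<open>tensor_map\<close> is a union over all representatives of the
      coproduct, so each of them has to give the same coset.\<close>
    have "tensor2 scale (free_map2 id antipode u) = tensor2 scale w" if "u \<in> comul \<Lambda>" for u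
      unfolding rel
      by (rule tensor2_rel_by_coord) (use R eq[OF that] in \<open>auto simp del: mem_idx\<close>)
    then show "tensor_map scale id antipode (comul \<Lambda>) = tensor2 scale w"
      unfolding tensor_map_def using comul_rep[of \<Lambda>] by auto
  qed
qed

text \<open>Since h C = C h, multiplying the right leg by a unit amounts to multiplying the left leg
  by it from the left, which permutes or kills coordinates.\<close>

lemma casimir_coord_mult:
  assumes "left_integral scale counit \<Lambda>" "(i, k, l) \<in> idx" "(j, p, q) \<in> idx"
  shows "casimir_coord \<Lambda> i k l * mat_unit j p q =
    (if i = j \<and> k = p then casimir_coord \<Lambda> i q l else 0)"
proof -
  have "casimir_coord \<Lambda> i k l * mat_unit j p q =
      sweedler (\<lambda>a b. scale (coord i k l a) (antipode b * mat_unit j p q)) \<Lambda>"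
    unfolding casimir_coord_def
    using linear_sweedler[of "\<lambda>t. t * mat_unit j p q"] by (simp add: endoI push_scale)
  also have "\<dots> = sweedler (\<lambda>a b. scale (coord i k l (mat_unit j p q * a)) (antipode b)) \<Lambda>"
    by (rule left_integral_casimir[OF assms(1) bilin_coord[OF assms(2)], symmetric])
  also have "\<dots> = (if i = j \<and> k = p then casimir_coord \<Lambda> i q l else 0)"
    unfolding coord_unit_mult[OF assms(2,3)]
    by (cases "i = j \<and> k = p") (auto simp: casimir_coord_def)
  finally show ?thesis .
qed

text \<open>Multiplying by the units of block \<open>i\<close> shows that
  \<open>casimir_coord \<Lambda> i k l\<close> lives in column \<open>k\<close> of that block, with
  entries independent of \<open>k\<close>. Reading them off at the reference index 0 gives the
  entries of A_i in row \<open>a\<close> and column \<open>l\<close>.\<close>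

lemma coord_casimir_coord:
  assumes "left_integral scale counit \<Lambda>" "(i, k, l) \<in> idx" "(j, a, b) \<in> idx"
  shows "coord j a b (casimir_coord \<Lambda> i k l) =
    (if i = j \<and> k = b then coord i a 0 (casimir_coord \<Lambda> i 0 l) else 0)"
proof (cases "i = j \<and> k = b")
  case True
  have "casimir_coord \<Lambda> i k l = casimir_coord \<Lambda> i 0 l * mat_unit i 0 k"
    using assms by (subst casimir_coord_mult) auto
  then show ?thesis using True assms by (auto simp: coord_mult_unit)
next
  case False
  have "casimir_coord \<Lambda> i k l = casimir_coord \<Lambda> i k l * mat_unit i k k"
    using assms by (subst casimir_coord_mult) auto
  then have "coord j a b (casimir_coord \<Lambda> i k l) =
      coord j a b (casimir_coord \<Lambda> i k l * mat_unit i k k)" by simp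
  then show ?thesis using False assms by (auto simp: coord_mult_unit)
qed

lemma sweedler_functional:
  assumes "\<And>x y. g (x + y) = g x + g y" "\<And>c x. g (scale c x) = c * g x"
  shows "sweedler (\<lambda>a b. scale (g a) (antipode b)) \<Lambda> =
    (\<Sum>(i, k, l)\<in>idx. scale (g (mat_unit i k l)) (casimir_coord \<Lambda> i k l))"
proof -
  have "sweedler (\<lambda>a b. scale (g a) (antipode b)) \<Lambda> = sweedler (\<lambda>a b. \<Sum>p\<in>idx.
      (case p of (i, k, l) \<Rightarrow> scale (g (mat_unit i k l)) (scale (coord i k l a) (antipode b)))) \<Lambda>"
    by (subst linear_functional_expansion[of g, OF assms])
      (simp add: case_prod_unfold scale_sum_left mult.commute)
  then show ?thesis
    by (simp add: sweedler_sum casimir_coord_def case_prod_unfold del: scale_scale)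
qed

text \<open>The (0, 0) entry in block \<open>j\<close> of the identity obtained by multiplying the
  two legs of C is the trace of A_j on one side and \<open>counit \<Lambda>\<close> on the
  other.\<close>

lemma casimir_trace:
  assumes "left_integral scale counit \<Lambda>" "j \<in> {1..s}"
  shows "(\<Sum>l<n j. coord j l 0 (casimir_coord \<Lambda> j 0 l)) = counit \<Lambda>"
proof -
  have j: "(j, 0, 0) \<in> idx" using assms(2) size_pos[OF assms(2)] by simp
  have "scale (counit \<Lambda>) 1 = sweedler (\<lambda>a b. a * antipode b) \<Lambda>"
    using sweedler_antipode_right[of "\<lambda>t. t"] by (simp add: endoI)
  also have "\<dots> = sweedler (\<lambda>a b. \<Sum>p\<in>idx.
      (case p of (i, k, l) \<Rightarrow> mat_unit i k l * scale (coord i k l a) (antipode b))) \<Lambda>"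
    by (subst unit_expansion) (simp add: sum_distrib_right case_prod_unfold push_scale)
  also have "\<dots> = (\<Sum>(i, k, l)\<in>idx. mat_unit i k l * casimir_coord \<Lambda> i k l)"
    unfolding sweedler_sum casimir_coord_def case_prod_unfold
    by (intro sum.cong refl, rule linear_sweedler[symmetric]) (simp add: endoI push_scale)
  finally have "counit \<Lambda> = coord j 0 0 (\<Sum>(i, k, l)\<in>idx. mat_unit i k l * casimir_coord \<Lambda> i k l)"
    using coord_scale[OF j, of "counit \<Lambda>" 1] by (simp add: coord_one[OF j])
  also have "\<dots> = (\<Sum>(i, k, l)\<in>idx.
      if i = j \<and> k = 0 then coord i l 0 (casimir_coord \<Lambda> i k l) else 0)"
    unfolding coord_sum[OF j]
    by (intro sum.cong refl) (auto simp: coord_unit_mult[OF j] simp del: mem_idx)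
  also have "\<dots> = (\<Sum>(i, k, l)\<in>(\<lambda>l. (j, 0, l)) ` {..<n j}.
      if i = j \<and> k = 0 then coord i l 0 (casimir_coord \<Lambda> i k l) else 0)"
    by (rule sum.mono_neutral_right) (use j finite_idx in auto)
  also have "\<dots> = (\<Sum>l<n j. coord j l 0 (casimir_coord \<Lambda> j 0 l))"
    by (subst sum.reindex) (auto simp: inj_on_def)
  finally show ?thesis by simp
qed

section \<open>The equivalence\<close>

lemma involutory_imp_casimir_coord:
  assumes integral: "left_integral scale counit \<Lambda>" "right_integral scale counit \<Lambda>" "counit \<Lambda> \<noteq> 0"
    and inv: "\<And>x. antipode (antipode x) = x"
    and i: "(i, k, l) \<in> idx"
  shows "(of_nat (n i) :: 'k) \<noteq> 0"
    and "casimir_coord \<Lambda> i k l = scale (counit \<Lambda> / of_nat (n i)) (mat_unit i l k)"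
proof -
  have swap: "mat_unit i p q * casimir_coord \<Lambda> i k l =
      (if l = q then casimir_coord \<Lambda> i k p else 0)"
    if k: "(i, k, l) \<in> idx" and p: "(i, p, q) \<in> idx" for k l p q
  proof -
    let ?u = "mat_unit i p q"
    have bi: "bilin (\<lambda>x y. scale (coord i k l (antipode x)) (antipode y))"
      by (rule bilinI) (simp_all add: coord_add[OF k] coord_scale[OF k] scale_left_distrib
        scale_right_distrib mult.commute)
    have "?u * casimir_coord \<Lambda> i k l =
        sweedler (\<lambda>a b. scale (coord i k l a) (?u * antipode b)) \<Lambda>"
      unfolding casimir_coord_def
      using linear_sweedler[of "\<lambda>t. ?u * t"] by (simp add: endoI push_scale)
    \<comment> \<open>This is S \<otimes> S applied to the right integral identity; as S^2 = id, the
      choice h = S(\<open>?u\<close>) brings back \<open>?u\<close>.\<close>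
    also have "\<dots> = sweedler (\<lambda>a b. scale (coord i k l (a * ?u)) (antipode b)) \<Lambda>"
      using right_integral_casimir[OF integral(2) bi, of "antipode ?u"]
      by (simp add: antipode_mult inv)
    also have "\<dots> = (if l = q then casimir_coord \<Lambda> i k p else 0)"
      unfolding coord_mult_unit[OF k p]
      by (cases "l = q") (auto simp: casimir_coord_def)
    finally show ?thesis .
  qed
  define A where "A l a = coord i a 0 (casimir_coord \<Lambda> i 0 l)" for l a
  define \<alpha> where "\<alpha> = A 0 0"
  \<comment> \<open>By \<open>swap\<close>, multiplying from the left by units moves every entry to
    position (0, 0), which makes A_i the scalar matrix with entry \<open>\<alpha>\<close>.\<close>
  have A: "A l q = (if l = q then \<alpha> else 0)" if "l < n i" "q < n i" for l q
  proof -
    have idx: "(i, 0, l) \<in> idx" "(i, 0, q) \<in> idx" "(i, 0, 0) \<in> idx"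
      using that i by auto
    have "A l q = coord i 0 0 (mat_unit i 0 q * casimir_coord \<Lambda> i 0 l)"
      using coord_unit_mult[OF idx(3,2)] by (simp add: A_def)
    also have "\<dots> = (if l = q then \<alpha> else 0)"
      by (simp add: swap[OF idx(1,2)] A_def \<alpha>_def coord_zero[OF idx(3)])
    finally show ?thesis .
  qed
  have "counit \<Lambda> = (\<Sum>l<n i. A l l)"
    using casimir_trace[OF integral(1), of i] i by (simp add: A_def)
  also have "\<dots> = of_nat (n i) * \<alpha>"
    using A by simp
  finally have trace: "counit \<Lambda> = of_nat (n i) * \<alpha>" .
  \<comment> \<open>A nonzero trace forces both factors of \<open>of_nat (n i) * \<alpha>\<close> to
    be nonzero, and then \<open>\<alpha>\<close> is the quotient in (ii).\<close>
  with integral(3) show ni: "(of_nat (n i) :: 'k) \<noteq> 0" by auto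
  show "casimir_coord \<Lambda> i k l = scale (counit \<Lambda> / of_nat (n i)) (mat_unit i l k)"
  proof (rule coord_eqI)
    fix j a b assume j: "(j, a, b) \<in> idx"
    have i': "(i, l, k) \<in> idx" using i by simp
    have "coord j a b (casimir_coord \<Lambda> i k l) = (if i = j \<and> k = b then A l a else 0)"
      unfolding coord_casimir_coord[OF integral(1) i j] A_def by (rule if_cong) auto
    also have "\<dots> = (if i = j \<and> k = b \<and> l = a then \<alpha> else 0)"
      using i j by (auto simp: A)
    also have "\<alpha> = counit \<Lambda> / of_nat (n i)" using trace ni by simp
    finally show "coord j a b (casimir_coord \<Lambda> i k l) =
        coord j a b (scale (counit \<Lambda> / of_nat (n i)) (mat_unit i l k))"
      by (auto simp: coord_scale[OF j] coord_unit[OF j i'])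
  qed
qed

text \<open>Any nonzero weights \<open>c i\<close> work: being constant on each block they preserve
  the inner symmetry, and being nonzero they keep C nondegenerate.\<close>

lemma casimir_coord_imp_involutory:
  assumes integral: "right_integral scale counit \<Lambda>"
    and c: "\<And>i. i \<in> {1..s} \<Longrightarrow> c i \<noteq> 0"
    and casimir: "\<And>i k l. (i, k, l) \<in> idx \<Longrightarrow> casimir_coord \<Lambda> i k l = scale (c i) (mat_unit i l k)"
  shows "antipode (antipode x) = x"
proof -
  have surj: "\<exists>y. antipode y = x" for x
  proof -
    \<comment> \<open>\<open>casimir_coord\<close> is the antipode of the same contraction taken
      without the antipode; dividing by \<open>c i\<close> gives a preimage of a matrix
      unit.\<close>
    define q where "q = (\<lambda>(i, l, k). scale (1 / c i) (sweedler (\<lambda>a b. scale (coord i k l a) b) \<Lambda>))"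
    have q: "antipode (q (i, l, k)) = mat_unit i l k" if "(i, l, k) \<in> idx" for i k l
    proof -
      have i: "(i, k, l) \<in> idx" "c i \<noteq> 0" using that c by auto
      have "antipode (q (i, l, k)) = scale (1 / c i) (casimir_coord \<Lambda> i k l)"
        by (simp add: q_def linear_sweedler[OF antipode_linear] casimir_coord_def)
      also have "\<dots> = mat_unit i l k"
        unfolding casimir[OF i(1)] using i(2) by simp
      finally show ?thesis .
    qed
    have "antipode (\<Sum>(i, l, k)\<in>idx. scale (coord i l k x) (q (i, l, k))) =
        (\<Sum>(i, l, k)\<in>idx. scale (coord i l k x) (mat_unit i l k))"
      unfolding antipode_sum by (intro sum.cong refl) (auto simp: q simp del: mem_idx)
    also have "\<dots> = x" by (rule unit_expansion[symmetric])
    finally show ?thesis by blast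
  qed
  \<comment> \<open>The inner symmetry contracted with one matrix entry: both sides are
    \<open>t * scale (c i) (mat_unit i l k)\<close>.\<close>
  have swap_coord: "t * casimir_coord \<Lambda> i k l =
      sweedler (\<lambda>a b. scale (coord i k l (a * t)) (antipode b)) \<Lambda>"
    if i: "(i, k, l) \<in> idx" for t i k l
  proof -
    have "sweedler (\<lambda>a b. scale (coord i k l (a * t)) (antipode b)) \<Lambda> =
        sweedler (\<lambda>a b. \<Sum>m<n i. scale (coord i m l t) (scale (coord i k m a) (antipode b))) \<Lambda>"
      by (simp add: coord_mult[OF i] scale_sum_left mult.commute)
    also have "\<dots> = (\<Sum>m<n i. scale (coord i m l t) (casimir_coord \<Lambda> i k m))"
      by (simp add: sweedler_sum casimir_coord_def del: scale_scale)
    also have "\<dots> = (\<Sum>m<n i. scale (coord i m l t) (scale (c i) (mat_unit i m k)))"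
      by (rule sum.cong) (use i in \<open>auto simp: casimir\<close>)
    also have "\<dots> = t * scale (c i) (mat_unit i l k)"
    proof (rule coord_eqI)
      fix j a b assume j: "(j, a, b) \<in> idx"
      have "coord j a b (\<Sum>m<n i. scale (coord i m l t) (scale (c i) (mat_unit i m k))) =
          (\<Sum>m<n i. if m = a then (if j = i \<and> b = k then c i * coord i a l t else 0) else 0)"
        unfolding coord_sum[OF j]
        by (rule sum.cong) (use i j in \<open>auto simp: coord_scale coord_unit\<close>)
      then show "coord j a b (\<Sum>m<n i. scale (coord i m l t) (scale (c i) (mat_unit i m k))) =
          coord j a b (t * scale (c i) (mat_unit i l k))"
        using i j by (auto simp: scale_mult_right[symmetric] coord_scale coord_mult_unit)
    qed
    finally show ?thesis using casimir[OF i] by simp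
  qed
  have swap: "t * sweedler (\<lambda>a b. scale (g a) (antipode b)) \<Lambda> =
      sweedler (\<lambda>a b. scale (g (a * t)) (antipode b)) \<Lambda>"
    if g: "\<And>x y. g (x + y) = g x + g y" "\<And>c x. g (scale c x) = c * g x" for g t
  proof -
    have "sweedler (\<lambda>a b. scale (g (a * t)) (antipode b)) \<Lambda> = sweedler (\<lambda>a b. \<Sum>p\<in>idx. (case p of
        (i, k, l) \<Rightarrow> scale (g (mat_unit i k l)) (scale (coord i k l (a * t)) (antipode b)))) \<Lambda>"
      by (subst linear_functional_expansion[of g, OF g])
        (simp add: case_prod_unfold scale_sum_left mult.commute)
    also have "\<dots> = (\<Sum>(i, k, l)\<in>idx. scale (g (mat_unit i k l)) (t * casimir_coord \<Lambda> i k l))"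
      unfolding sweedler_sum
      by (intro sum.cong refl) (auto simp: swap_coord simp del: scale_scale mem_idx)
    finally show ?thesis
      by (simp add: sweedler_functional[of g, OF g] sum_distrib_left scale_mult_right[symmetric]
        case_prod_unfold)
  qed
  have functional_unique: "g1 = g2"
    if g1: "\<And>x y. g1 (x + y) = g1 x + g1 y" "\<And>c x. g1 (scale c x) = c * g1 x"
      and g2: "\<And>x y. g2 (x + y) = g2 x + g2 y" "\<And>c x. g2 (scale c x) = c * g2 x"
      and eq: "sweedler (\<lambda>a b. scale (g1 a) (antipode b)) \<Lambda> =
        sweedler (\<lambda>a b. scale (g2 a) (antipode b)) \<Lambda>"
    for g1 g2
  proof -
    \<comment> \<open>Nondegeneracy: contracting C with \<open>g\<close> yields a matrix whose
      entries are the values of \<open>g\<close> on the units, transposed and weighted by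
      \<open>c i\<close>.\<close>
    have coeff: "coord i l k (sweedler (\<lambda>a b. scale (g a) (antipode b)) \<Lambda>) = c i * g (mat_unit i k l)"
      if g: "\<And>x y. g (x + y) = g x + g y" "\<And>c x. g (scale c x) = c * g x" and i: "(i, l, k) \<in> idx"
      for g i k l
    proof -
      have "coord i l k (sweedler (\<lambda>a b. scale (g a) (antipode b)) \<Lambda>) =
          (\<Sum>p\<in>idx. if p = (i, k, l) then c i * g (mat_unit i k l) else 0)"
        unfolding sweedler_functional[of g, OF g] coord_sum[OF i]
        by (intro sum.cong refl) (use i in \<open>auto simp: casimir coord_scale coord_unit split: if_splits\<close>)
      then show ?thesis using i finite_idx by simp
    qed
    have "g1 (mat_unit i k l) = g2 (mat_unit i k l)" if "(i, k, l) \<in> idx" for i k l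
      using coeff[of g1 i l k, OF g1] coeff[of g2 i l k, OF g2] that eq c[of i] by auto
    then have "(\<Sum>(i, k, l)\<in>idx. coord i k l x * g1 (mat_unit i k l)) =
        (\<Sum>(i, k, l)\<in>idx. coord i k l x * g2 (mat_unit i k l))" for x
      by (intro sum.cong refl) auto
    then show ?thesis
      unfolding linear_functional_expansion[of g1, OF g1, symmetric]
        linear_functional_expansion[of g2, OF g2, symmetric] by (rule ext)
  qed
  have cube: "antipode (antipode (antipode h)) = antipode h" for h
  proof (rule coord_eqI)
    fix i k l assume i: "(i, k, l) \<in> idx"
    note coord = coord_add[OF i] coord_scale[OF i]
    have bi: "bilin (\<lambda>x y. scale (coord i k l (antipode x)) (antipode y))"
      by (rule bilinI) (simp_all add: coord scale_left_distrib scale_right_distrib mult.commute)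
    have "sweedler (\<lambda>a b. scale (coord i k l (antipode (antipode a) * antipode h)) (antipode b)) \<Lambda> =
        sweedler (\<lambda>a b. scale (coord i k l (antipode (antipode a))) (antipode h * antipode b)) \<Lambda>"
      using right_integral_casimir[OF integral bi, of h] by (simp add: antipode_mult)
    also have "\<dots> = antipode h *
        sweedler (\<lambda>a b. scale (coord i k l (antipode (antipode a))) (antipode b)) \<Lambda>"
      using linear_sweedler[of "\<lambda>t. antipode h * t"] by (simp add: endoI push_scale)
    \<comment> \<open>The inner symmetry for the functional
      \<open>\<lambda>a. coord i k l (antipode (antipode a))\<close> moves S(h) inside S^2.\<close>
    also have "\<dots> =
        sweedler (\<lambda>a b. scale (coord i k l (antipode (antipode (a * antipode h)))) (antipode b)) \<Lambda>"
      by (rule swap[of "\<lambda>a. coord i k l (antipode (antipode a))"]) (simp_all add: coord)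
    finally have "(\<lambda>a. coord i k l (antipode (antipode a) * antipode h)) =
        (\<lambda>a. coord i k l (antipode (antipode (a * antipode h))))"
      by (intro functional_unique) (simp_all add: coord push_scale)
    from fun_cong[OF this, of 1] show
      "coord i k l (antipode (antipode (antipode h))) = coord i k l (antipode h)"
      by (simp add: antipode_one)
  qed
  from surj obtain y where "antipode y = x" by blast
  with cube show ?thesis by metis
qed

end

theorem proposition3p3:
  fixes scale :: "'k::field \<Rightarrow> 'h::ring_1 \<Rightarrow> 'h"
    and comul :: "'h \<Rightarrow> ('h \<times> 'h \<Rightarrow>\<^sub>0 'k) set"
    and counit :: "'h \<Rightarrow> 'k"
    and antipode :: "'h \<Rightarrow> 'h"
    and \<Lambda> :: 'h
    and s :: nat and n :: "nat \<Rightarrow> nat" and \<phi> :: "'h \<Rightarrow> nat \<Rightarrow> 'k mat"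
  assumes hopf: "hopf_algebra scale comul counit antipode"
    and fin_dim: "\<exists>B. finite B \<and> module.span scale B = UNIV"
    and integral: "left_integral scale counit \<Lambda> \<or> right_integral scale counit \<Lambda>"
    and nonzero: "\<Lambda> \<noteq> 0"
    and wedderburn: "wedderburn_decomposition scale s n \<phi>"
  shows "antipode \<circ> antipode = id \<longleftrightarrow>
    (\<forall>i\<in>{1..s}. (of_nat (n i) :: 'k) \<noteq> 0) \<and>
    tensor_map scale id antipode (comul \<Lambda>) =
      tensor2 scale (\<Sum>i=1..s. free_scale (counit \<Lambda> / of_nat (n i)) (factor_casimir s n \<phi> i))"
proof -
  interpret split_hopf_algebra scale comul counit antipode s n \<phi>
    using hopf wedderburn by (rule split_hopf_algebra.intro)
  note integral' = integral_two_sided[OF integral nonzero]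
  let ?w = "\<Sum>i=1..s. free_scale (counit \<Lambda> / of_nat (n i)) (factor_casimir s n \<phi> i)"
  have contract: "lin_ext scale (\<lambda>(x, y). scale (coord i k l x) y) ?w =
      scale (counit \<Lambda> / of_nat (n i)) (mat_unit i l k)" if i: "(i, k, l) \<in> idx" for i k l
  proof -
    have "lin_ext scale (\<lambda>(x, y). scale (coord i k l x) y) ?w =
        (\<Sum>j=1..s. if j = i then scale (counit \<Lambda> / of_nat (n i)) (mat_unit i l k) else 0)"
      unfolding lin_ext_sum lin_ext_free_scale
      by (intro sum.cong refl) (simp add: contract_factor_casimir[OF i])
    then show ?thesis using i by simp
  qed
  show ?thesis
    unfolding casimir_tensor_eq_iff
  proof (intro iffI conjI ballI)
    fix i assume "antipode \<circ> antipode = id" "i \<in> {1..s}"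
    \<comment> \<open>Every block has size at least 1, so index 0 gives a triple to which the
      coordinate lemma applies.\<close>
    moreover from this have "(i, 0, 0) \<in> idx" using size_pos[of i] by simp
    ultimately show "(of_nat (n i) :: 'k) \<noteq> 0"
      using involutory_imp_casimir_coord(1)[OF integral'] by (metis comp_apply id_apply)
  next
    fix p assume "antipode \<circ> antipode = id" "p \<in> idx"
    moreover obtain i k l where "p = (i, k, l)" by (cases p)
    ultimately show "case p of (i, k, l) \<Rightarrow>
        casimir_coord \<Lambda> i k l = lin_ext scale (\<lambda>(x, y). scale (coord i k l x) y) ?w"
      using involutory_imp_casimir_coord(2)[OF integral', of i k l] contract[of i k l]
      by (auto simp: fun_eq_iff simp del: mem_idx)
  next
    assume *: "(\<forall>i\<in>{1..s}. (of_nat (n i) :: 'k) \<noteq> 0) \<and> (\<forall>(i, k, l)\<in>idx.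
      casimir_coord \<Lambda> i k l = lin_ext scale (\<lambda>(x, y). scale (coord i k l x) y) ?w)"
    have "antipode (antipode x) = x" for x
      \<comment> \<open>The weights are nonzero because both \<open>counit \<Lambda>\<close> and
        each \<open>n i\<close> are nonzero in the field.\<close>
      by (rule casimir_coord_imp_involutory[OF integral'(2), of "\<lambda>i. counit \<Lambda> / of_nat (n i)"])
        (use * integral'(3) contract in \<open>auto simp del: mem_idx\<close>)
    then show "antipode \<circ> antipode = id" by auto
  qed
qed

end
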